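(* Let $n\geq 1$ and let $\sigma$ be a short Catalan--Spitzer permutation of order $n$ (a permutation of $\{1,\ldots,n\}$). If $\sigma$ is $i$-decomposable for some $i<n$, then its $i$-flip $\phi_i(\sigma)$ is also a short Catalan--Spitzer permutation.
   Context: A Catalan--Spitzer path of order $n$ is a lattice path $(0,z'_0),(1,z'_1),\ldots,(2n+1,z'_{2n+1})$ with $z'_0=z'_{2n+1}=0$, consisting of $n+1$ up steps $(1,n)$ and $n$ down steps $(1,-(n+1))$, with $z'_j>0$ for $1\leq j\leq 2n$. Let $j_1<\cdots<j_n$ be the indices $j\in\{1,\ldots,2n\}$ with $z'_j<z'_{j+1}$. The short Catalan--Spitzer permutation of the path is the permutation $\sigma$ of $\{1,\ldots,n\}$ with $\sigma(a)<\sigma(b)$ iff $z'_{j_a}<z'_{j_b}$; a short Catalan--Spitzer permutation of order $n$ is any permutation so obtained. For an ordered alphabet $X$, a permutation of $X$ is a word containing each letter of $X$ exactly once. For $x\in X$, a permutation $w$ of $X$ is $x$-decomposable if it can be written as a concatenation $w=w_1w_2w_3$ where all letters of $w_1$ and $w_3$ are less than $x$, all letters of $w_2$ are greater than or equal to $x$, and $x$ is the first or the last letter of $w_2$ (an $x$-decomposition). The $x$-flip $\phi_x(w)$ of such $w$ is obtained by moving the letter $x$ from its end of the subword $w_2$ to the other end of $w_2$. *)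

theory Defs
  imports "HOL-Combinatorics.Multiset_Permutations"
begin

(* A path is given by its height function; only z 0, ..., z (2 * n + 1) are relevant. *)
definition catalan_spitzer_path :: "nat \<Rightarrow> (nat \<Rightarrow> int) \<Rightarrow> bool" where
  "catalan_spitzer_path n z \<longleftrightarrow>
     z 0 = 0 \<and> z (2 * n + 1) = 0 \<and>
     (\<forall>j\<le>2 * n. z (Suc j) - z j = int n \<or> z (Suc j) - z j = - (int n + 1)) \<and>
     card {j. j \<le> 2 * n \<and> z (Suc j) - z j = int n} = n + 1 \<and>
     card {j. j \<le> 2 * n \<and> z (Suc j) - z j = - (int n + 1)} = n \<and>
     (\<forall>j\<in>{1..2 * n}. z j > 0)"

definition ascent_indices :: "nat \<Rightarrow> (nat \<Rightarrow> int) \<Rightarrow> nat list" where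
  "ascent_indices n z = sorted_list_of_set {j \<in> {1..2 * n}. z j < z (Suc j)}"

(* A permutation s of {1..n} is the word s(1) ... s(n); s(a) is the list entry at position a - 1. *)
definition is_short_permutation_of_path :: "nat \<Rightarrow> (nat \<Rightarrow> int) \<Rightarrow> nat list \<Rightarrow> bool" where
  "is_short_permutation_of_path n z \<sigma> \<longleftrightarrow>
     \<sigma> \<in> permutations_of_set {1..n} \<and>
     (\<forall>a<n. \<forall>b<n. \<sigma> ! a < \<sigma> ! b \<longleftrightarrow>
        z (ascent_indices n z ! a) < z (ascent_indices n z ! b))"

definition short_catalan_spitzer_permutation :: "nat \<Rightarrow> nat list \<Rightarrow> bool" where
  "short_catalan_spitzer_permutation n \<sigma> \<longleftrightarrow>
     (\<exists>z. catalan_spitzer_path n z \<and> is_short_permutation_of_path n z \<sigma>)"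

(* A word w with distinct letters is a permutation of the alphabet X = set w,
   so X is not a separate parameter. *)
definition is_decomposition ::
    "'a::linorder \<Rightarrow> 'a list \<Rightarrow> 'a list \<Rightarrow> 'a list \<Rightarrow> 'a list \<Rightarrow> bool" where
  "is_decomposition x w w1 w2 w3 \<longleftrightarrow>
     distinct w \<and> w = w1 @ w2 @ w3 \<and>
     (\<forall>y\<in>set w1 \<union> set w3. y < x) \<and> (\<forall>y\<in>set w2. y \<ge> x) \<and>
     w2 \<noteq> [] \<and> (hd w2 = x \<or> last w2 = x)"

definition decomposable :: "'a::linorder \<Rightarrow> 'a list \<Rightarrow> bool" where
  "decomposable x w \<longleftrightarrow> (\<exists>w1 w2 w3. is_decomposition x w w1 w2 w3)"

definition move_to_other_end :: "'a \<Rightarrow> 'a list \<Rightarrow> 'a list" where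
  "move_to_other_end x w = (if hd w = x then tl w @ [x] else x # butlast w)"

definition flip :: "'a::linorder \<Rightarrow> 'a list \<Rightarrow> 'a list" where
  "flip x w = (THE w'. \<exists>w1 w2 w3. is_decomposition x w w1 w2 w3 \<and>
                        w' = w1 @ move_to_other_end x w2 @ w3)"

lemma is_decomposition_takeWhile:
  assumes "is_decomposition x w w1 w2 w3"
  shows "w1 = takeWhile (\<lambda>y. y < x) w"
    and "w2 = takeWhile (\<lambda>y. y \<ge> x) (dropWhile (\<lambda>y. y < x) w)"
    and "w3 = dropWhile (\<lambda>y. y \<ge> x) (dropWhile (\<lambda>y. y < x) w)"
proof -
  have w: "w = w1 @ w2 @ w3" and lt: "\<forall>y\<in>set w1. y < x" "\<forall>y\<in>set w3. y < x"
    and ge: "\<forall>y\<in>set w2. y \<ge> x" and ne: "w2 \<noteq> []"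
    using assms by (auto simp: is_decomposition_def)
  from ne obtain y ys where w2: "w2 = y # ys" by (cases w2) auto
  with ge have "\<not> y < x" by auto
  then show "w1 = takeWhile (\<lambda>y. y < x) w" using w lt w2 by simp
  have drop: "dropWhile (\<lambda>y. y < x) w = w2 @ w3"
    using w lt w2 \<open>\<not> y < x\<close> by simp
  have "takeWhile (\<lambda>y. y \<ge> x) w3 = []" "dropWhile (\<lambda>y. y \<ge> x) w3 = w3"
    using lt(2) by (cases w3; auto)+
  then show "w2 = takeWhile (\<lambda>y. y \<ge> x) (dropWhile (\<lambda>y. y < x) w)"
    and "w3 = dropWhile (\<lambda>y. y \<ge> x) (dropWhile (\<lambda>y. y < x) w)"
    using drop ge by simp_all
qed

lemma flip_eq:
  assumes "is_decomposition x w w1 w2 w3"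
  shows "flip x w = w1 @ move_to_other_end x w2 @ w3"
  unfolding flip_def
proof (rule the_equality)
  show "\<exists>v1 v2 v3. is_decomposition x w v1 v2 v3 \<and>
      w1 @ move_to_other_end x w2 @ w3 = v1 @ move_to_other_end x v2 @ v3"
    using assms by blast
next
  fix w'
  assume "\<exists>v1 v2 v3. is_decomposition x w v1 v2 v3 \<and>
      w' = v1 @ move_to_other_end x v2 @ v3"
  then obtain v1 v2 v3 where v: "is_decomposition x w v1 v2 v3"
    and w': "w' = v1 @ move_to_other_end x v2 @ v3" by blast
  have "v1 = w1" "v2 = w2" "v3 = w3"
    using is_decomposition_takeWhile[OF v] is_decomposition_takeWhile[OF assms] by auto
  with w' show "w' = w1 @ move_to_other_end x w2 @ w3" by simp
qed

end

theory Submission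
  imports Defs
begin

text \<open>
  Let \<open>j\<^sub>0 < \<dots> < j\<^sub>n\<^sub>-\<^sub>1\<close> be the positive ascent indices of a Catalan--Spitzer path of order \<open>n\<close> and
  put \<open>h\<^sub>a = 1 + 2 a - j\<^sub>a\<close>. The height at \<open>j\<^sub>a\<close> is \<open>(n + 1) h\<^sub>a + (n - a)\<close>, so heights are compared
  by the level \<open>h\<^sub>a\<close> first, and equal levels are ordered decreasingly from left to right. The level
  sequences that occur are exactly those with \<open>h\<^sub>0 = 0\<close> and \<open>h\<^sub>a\<^sub>+\<^sub>1 \<le> h\<^sub>a + 1\<close>. An \<open>i\<close>-flip that moves
  \<open>i\<close> to the right (left) lowers (raises) the levels of all letters above \<open>i\<close> by one, and this
  preserves the conditions on the level sequence.
\<close>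

text \<open>Levels are attached to letters rather than positions, so a letter keeps its level when a
  flip moves it. The \<open>sorted_wrt\<close> clause compares a letter only with later ones; in a
  word with distinct letters it also says that equal levels decrease from left to right.\<close>

definition level_function :: "('a::linorder \<Rightarrow> nat) \<Rightarrow> 'a list \<Rightarrow> bool" where
  "level_function L w \<longleftrightarrow>
     (w \<noteq> [] \<longrightarrow> L (hd w) = 0) \<and> successively (\<lambda>x y. L y \<le> L x + 1) w \<and>
     sorted_wrt (\<lambda>x y. x < y \<longleftrightarrow> L x < L y) w"

section \<open>Paths recovered from their ascent positions\<close>

definition up_steps_before :: "nat \<Rightarrow> (nat \<Rightarrow> nat) \<Rightarrow> nat \<Rightarrow> nat" where
  "up_steps_before n f j = card (insert 0 (f ` {..<n}) \<inter> {..<j})"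

text \<open>With \<open>u\<close> up steps among the first \<open>j\<close> steps the height is
  \<open>n * u - (n + 1) * (j - u)\<close>, which rearranges to this formula. The function
  \<open>f\<close> lists the positive ascent indices; the initial up step at index 0 is added by
  \<open>up_steps_before\<close>.\<close>

definition path_of_ascents :: "nat \<Rightarrow> (nat \<Rightarrow> nat) \<Rightarrow> nat \<Rightarrow> int" where
  "path_of_ascents n f j = (2 * int n + 1) * int (up_steps_before n f j) - (int n + 1) * int j"

lemma up_steps_before_Suc:
  "up_steps_before n f (Suc j) =
     up_steps_before n f j + (if j \<in> insert 0 (f ` {..<n}) then 1 else 0)"
proof -
  have "insert 0 (f ` {..<n}) \<inter> {..<Suc j} =
      (if j \<in> insert 0 (f ` {..<n}) then insert j (insert 0 (f ` {..<n}) \<inter> {..<j})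
       else insert 0 (f ` {..<n}) \<inter> {..<j})"
    by (auto simp: less_Suc_eq)
  then show ?thesis
    unfolding up_steps_before_def by (simp split: if_splits)
qed

lemma path_of_ascents_0 [simp]: "path_of_ascents n f 0 = 0"
  by (simp add: path_of_ascents_def up_steps_before_def)

lemma path_of_ascents_step:
  "path_of_ascents n f (Suc j) - path_of_ascents n f j =
     (if j \<in> insert 0 (f ` {..<n}) then int n else - (int n + 1))"
  unfolding path_of_ascents_def up_steps_before_Suc by (simp add: algebra_simps)

text \<open>The up steps before \<open>f a\<close> are the one at 0 and those at \<open>f 0\<close>,
  ..., \<open>f (a - 1)\<close>.\<close>

lemma up_steps_before_ascent:
  assumes mono: "strict_mono_on {..<n} f" and pos: "\<forall>a<n. 1 \<le> f a" and "a < n"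
  shows "up_steps_before n f (f a) = a + 1"
proof -
  have less: "f b < f a \<longleftrightarrow> b < a" if "b < n" for b
    using strict_mono_on_less[OF mono, of b a] that \<open>a < n\<close> by simp
  have "insert 0 (f ` {..<n}) \<inter> {..<f a} = insert 0 (f ` {..<a})"
    using less pos \<open>a < n\<close> by (auto simp: Suc_le_eq)
  moreover have "0 \<notin> f ` {..<a}"
    using pos \<open>a < n\<close> by (metis imageE lessThan_iff less_trans not_one_le_zero)
  moreover have "inj_on f {..<a}"
    using strict_mono_on_imp_inj_on[OF mono] \<open>a < n\<close> by (auto elim: inj_on_subset)
  ultimately show ?thesis
    unfolding up_steps_before_def by (simp add: card_image)
qed

lemma path_of_ascents_at_ascent:
  assumes "strict_mono_on {..<n} f" and "\<forall>a<n. 1 \<le> f a" and "a < n"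
  shows "path_of_ascents n f (f a) = (int n + 1) * (1 + 2 * int a - int (f a)) + (int n - int a)"
  unfolding path_of_ascents_def up_steps_before_ascent[OF assms] by (simp add: algebra_simps)

text \<open>The offsets \<open>n - a\<close> and \<open>n - b\<close> lie between 1 and
  \<open>n\<close>, so their difference is smaller than the weight \<open>n + 1\<close> of one level
  and can only break ties.\<close>

lemma lexicographic_height_less_iff:
  fixes n a b h k :: nat
  assumes "a < n" "b < n"
  shows "(int n + 1) * int h + (int n - int a) < (int n + 1) * int k + (int n - int b) \<longleftrightarrow>
    h < k \<or> h = k \<and> b < a"
proof -
  have less: "(int n + 1) * int h + (int n - int a) < (int n + 1) * int k + (int n - int b)"
    if "h < k" "a < n" "b < n" for h k a b :: nat
  proof -
    have "(int n + 1) * (int h + 1) \<le> (int n + 1) * int k"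
      using that by (intro mult_left_mono) auto
    then show ?thesis using that by (simp add: algebra_simps)
  qed
  consider "h < k" | "h = k" | "k < h" by linarith
  then show ?thesis
    using less[of h k a b] less[of k h b a] assms by cases auto
qed

text \<open>Agreement is required only up to \<open>2 * n + 1\<close>, because a path leaves the
  later values of \<open>z\<close> unspecified. The lemma thus serves both given and constructed
  paths.\<close>

lemma ascent_indices_path_of_ascents:
  assumes mono: "strict_mono_on {..<n} f" and ran: "f ` {..<n} \<subseteq> {1..2 * n}"
    and eq: "\<forall>j\<le>2 * n + 1. z j = path_of_ascents n f j"
  shows "ascent_indices n z = map f [0..<n]"
proof -
  have "z j < z (Suc j) \<longleftrightarrow> j \<in> f ` {..<n}" if "j \<in> {1..2 * n}" for j
    using path_of_ascents_step[of n f j] that eq by (auto split: if_splits)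
  then have "{j \<in> {1..2 * n}. z j < z (Suc j)} = f ` {..<n}"
    using ran by auto
  moreover have "sorted_wrt (<) (map f [0..<n])"
    by (auto simp: sorted_wrt_iff_nth_less intro!: strict_mono_onD[OF mono])
  ultimately show ?thesis
    unfolding ascent_indices_def
    by (metis atLeast_upt image_set sorted_list_of_set.idem_if_sorted_distinct
        strict_sorted_iff)
qed

lemma catalan_spitzer_pathE:
  assumes path: "catalan_spitzer_path n z" and "n \<ge> 1"
  obtains f where "strict_mono_on {..<n} f" "f ` {..<n} \<subseteq> {1..2 * n}"
    "\<forall>j\<le>2 * n + 1. z j = path_of_ascents n f j"
proof -
  define U where "U = {j. j \<le> 2 * n \<and> z (Suc j) - z j = int n}"
  have z0: "z 0 = 0" and cardU: "card U = n + 1"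
    and step: "\<And>j. j \<le> 2 * n \<Longrightarrow> z (Suc j) - z j = int n \<or> z (Suc j) - z j = - (int n + 1)"
    and pos: "\<And>j. j \<in> {1..2 * n} \<Longrightarrow> z j > 0"
    using path by (auto simp: catalan_spitzer_path_def U_def)
  have finU: "finite U" by (simp add: U_def)
  \<comment> \<open>A first step down would make \<open>z 1\<close> negative. Removing 0 from
    \<open>U\<close> therefore leaves exactly \<open>n\<close> ascents, which \<open>xs\<close>
    lists in increasing order.\<close>
  have "0 \<in> U"
    using step[of 0] pos[of 1] z0 \<open>n \<ge> 1\<close> by (auto simp: U_def)
  define xs where "xs = sorted_list_of_set (U - {0})"
  have len: "length xs = n"
    using cardU finU \<open>0 \<in> U\<close> by (simp add: xs_def)
  have setxs: "set xs = U - {0}" and sortedxs: "sorted_wrt (<) xs"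
    using finU by (simp_all add: xs_def)
  have image: "(!) xs ` {..<n} = U - {0}"
    using setxs len by (auto simp: set_conv_nth)
  have insert: "insert 0 ((!) xs ` {..<n}) = U"
    using image \<open>0 \<in> U\<close> by auto
  show ?thesis
  proof
    show "strict_mono_on {..<n} ((!) xs)"
      using sortedxs len by (auto simp: strict_mono_on_def sorted_wrt_iff_nth_less)
    show "(!) xs ` {..<n} \<subseteq> {1..2 * n}"
      unfolding image by (auto simp: U_def)
    have "z j = path_of_ascents n ((!) xs) j" if "j \<le> 2 * n + 1" for j
      using that
    proof (induction j)
      case 0
      show ?case by (simp add: z0)
    next
      case (Suc j)
      then show ?case
        using path_of_ascents_step[of n "(!) xs" j] step[of j]
        unfolding insert by (auto simp: U_def split: if_splits)
    qed
    then show "\<forall>j\<le>2 * n + 1. z j = path_of_ascents n ((!) xs) j" by blast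
  qed
qed

text \<open>The bound on \<open>f\<close> says that every level \<open>1 + 2 * a - f a\<close> is
  nonnegative. This suffices for positivity, since the path only descends from one peak to the next
  ascent index, where its height is at least \<open>n - a\<close>.\<close>

lemma catalan_spitzer_path_of_ascents:
  assumes mono: "strict_mono_on {..<n} f" and ran: "f ` {..<n} \<subseteq> {1..2 * n}"
    and bound: "\<forall>a<n. f a \<le> 1 + 2 * a"
  shows "catalan_spitzer_path n (path_of_ascents n f)"
proof -
  let ?U = "insert 0 (f ` {..<n})"
  have inj: "inj_on f {..<n}" using strict_mono_on_imp_inj_on[OF mono] .
  have "0 \<notin> f ` {..<n}" using ran by auto
  then have cardU: "card ?U = n + 1"
    using inj by (simp add: card_image)
  have subU: "?U \<subseteq> {..2 * n}" using ran by auto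
  have up: "{j. j \<le> 2 * n \<and> path_of_ascents n f (Suc j) - path_of_ascents n f j = int n} = ?U"
    unfolding path_of_ascents_step using subU by (auto split: if_splits)
  have down: "{j. j \<le> 2 * n \<and> path_of_ascents n f (Suc j) - path_of_ascents n f j =
      - (int n + 1)} = {..2 * n} - ?U"
    unfolding path_of_ascents_step by (auto split: if_splits)
  have carddown: "card ({..2 * n} - ?U) = n"
    using cardU subU by (subst card_Diff_subset) (auto intro: finite_subset)
  have total: "up_steps_before n f (2 * n + 1) = n + 1"
  proof -
    have "?U \<inter> {..<2 * n + 1} = ?U" using subU by auto
    then show ?thesis unfolding up_steps_before_def using cardU by simp
  qed
  have pos: "path_of_ascents n f j > 0" if "j \<in> {1..2 * n}" for j
  proof (cases "\<exists>a<n. j \<le> f a")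
    case True
    \<comment> \<open>\<open>f k\<close> is the first positive ascent index at or after
      \<open>j\<close>, so the \<open>k + 1\<close> up steps at 0 and \<open>f 0\<close>, ...,
      \<open>f (k - 1)\<close> all precede \<open>j\<close>.\<close>
    define k where "k = (LEAST a. a < n \<and> j \<le> f a)"
    have k: "k < n" "j \<le> f k"
      using True LeastI_ex[of "\<lambda>a. a < n \<and> j \<le> f a"] by (auto simp: k_def)
    have "f a < j" if "a < k" for a
      using not_less_Least[of a "\<lambda>a. a < n \<and> j \<le> f a"] that k by (auto simp: k_def)
    then have "insert 0 (f ` {..<k}) \<subseteq> ?U \<inter> {..<j}"
      using k \<open>j \<in> {1..2 * n}\<close> by auto
    then have "card (insert 0 (f ` {..<k})) \<le> up_steps_before n f j"
      unfolding up_steps_before_def by (intro card_mono) auto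
    moreover have "card (insert 0 (f ` {..<k})) = k + 1"
    proof -
      have "0 \<notin> f ` {..<k}" "inj_on f {..<k}"
        using \<open>0 \<notin> f ` {..<n}\<close> inj k by (auto elim: inj_on_subset)
      then show ?thesis by (simp add: card_image)
    qed
    ultimately have "(2 * int n + 1) * (int k + 1) \<le> (2 * int n + 1) * int (up_steps_before n f j)"
      by (intro mult_left_mono) auto
    moreover have "j \<le> 1 + 2 * k" using bound k by force
    then have "(int n + 1) * int j \<le> (int n + 1) * (1 + 2 * int k)"
      by (intro mult_left_mono) auto
    \<comment> \<open>The constant is
      \<open>(2 * n + 1) * (k + 1) - (n + 1) * (1 + 2 * k) = n - k\<close>.\<close>
    ultimately have "path_of_ascents n f j \<ge> int n - int k"
      unfolding path_of_ascents_def by (simp add: algebra_simps)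
    then show ?thesis using k by simp
  next
    case False
    \<comment> \<open>All up steps lie before \<open>j\<close>; the remaining
      \<open>2 * n + 1 - j\<close> steps go down to 0, which determines the height.\<close>
    then have "?U \<inter> {..<j} = ?U" using that by (auto simp: not_le)
    then have "path_of_ascents n f j = (int n + 1) * (2 * int n + 1 - int j)"
      unfolding path_of_ascents_def up_steps_before_def using cardU by (simp add: algebra_simps)
    moreover have "2 * int n + 1 - int j > 0" using that by auto
    ultimately show ?thesis by simp
  qed
  have "path_of_ascents n f (2 * n + 1) = 0"
    unfolding path_of_ascents_def total by (simp add: algebra_simps)
  moreover have "path_of_ascents n f (Suc j) - path_of_ascents n f j = int n \<or>
      path_of_ascents n f (Suc j) - path_of_ascents n f j = - (int n + 1)" for j
    unfolding path_of_ascents_step by auto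
  ultimately show ?thesis
    unfolding catalan_spitzer_path_def up down using cardU carddown pos by simp
qed

section \<open>Short permutations as words with a level function\<close>

lemma level_function_nth_less_iff:
  assumes "level_function L w" "distinct w" "a < length w" "b < length w"
  shows "w ! a < w ! b \<longleftrightarrow> L (w ! a) < L (w ! b) \<or> L (w ! a) = L (w ! b) \<and> b < a"
proof -
  have less: "w ! a < w ! b \<longleftrightarrow> L (w ! a) < L (w ! b)" if "a < b" "b < length w" for a b
    using assms(1) that by (auto simp: level_function_def sorted_wrt_iff_nth_less)
  consider "a < b" | "a = b" | "b < a" by linarith
  then show ?thesis
  proof cases
    case 3
    \<comment> \<open>Distinctness turns the failure of \<open>w ! b < w ! a\<close> into the
      reverse strict inequality, so a tie of levels favours the later position as the larger-index
      one with the smaller letter.\<close>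
    then have "w ! a \<noteq> w ! b" using assms nth_eq_iff_index_eq by blast
    then show ?thesis using less[of b a] 3 assms by (auto simp: not_less)
  qed (use less[of a b] assms in auto)
qed

text \<open>Levels start at 0 and climb by at most one per letter. This makes the natural
  subtraction in \<open>1 + 2 * a - L (w ! a)\<close> exact and its value positive.\<close>

lemma level_function_nth_le:
  assumes "level_function L w" "a < length w"
  shows "L (w ! a) \<le> a"
  using assms(2)
proof (induction a)
  case 0
  then show ?case using assms(1) by (auto simp: level_function_def hd_conv_nth)
next
  case (Suc a)
  have "L (w ! Suc a) \<le> L (w ! a) + 1"
    using assms(1) Suc.prems by (auto simp: level_function_def successively_conv_nth)
  then show ?case using Suc by simp
qed

text \<open>Ascent positions and levels determine each other by
  \<open>h a = 1 + 2 * a - f a\<close>. Under this change of variables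
  \<open>f a < f (Suc a)\<close> becomes \<open>h (Suc a) \<le> h a + 1\<close>, and positivity of
  the path becomes \<open>h a \<ge> 0\<close>.\<close>

lemma short_catalan_spitzer_permutation_iff_level_function:
  assumes "n \<ge> 1"
  shows "short_catalan_spitzer_permutation n \<sigma> \<longleftrightarrow>
    \<sigma> \<in> permutations_of_set {1..n} \<and> (\<exists>L. level_function L \<sigma>)"
proof
  assume "short_catalan_spitzer_permutation n \<sigma>"
  then obtain z where path: "catalan_spitzer_path n z"
    and perm: "\<sigma> \<in> permutations_of_set {1..n}"
    and order: "\<And>a b. a < n \<Longrightarrow> b < n \<Longrightarrow> \<sigma> ! a < \<sigma> ! b \<longleftrightarrow>
        z (ascent_indices n z ! a) < z (ascent_indices n z ! b)"
    by (auto simp: short_catalan_spitzer_permutation_def is_short_permutation_of_path_def)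
  obtain f where mono: "strict_mono_on {..<n} f" and ran: "f ` {..<n} \<subseteq> {1..2 * n}"
    and eq: "\<forall>j\<le>2 * n + 1. z j = path_of_ascents n f j"
    using catalan_spitzer_pathE[OF path \<open>n \<ge> 1\<close>] .
  have f_ge: "1 \<le> f a" and f_le: "f a \<le> 2 * n" if "a < n" for a
    using ran that by (auto simp: image_subset_iff)
  have nth: "ascent_indices n z ! a = f a" if "a < n" for a
    using ascent_indices_path_of_ascents[OF mono ran eq] that by simp
  have z_f: "z (f a) = (int n + 1) * (1 + 2 * int a - int (f a)) + (int n - int a)" if "a < n" for a
    using path_of_ascents_at_ascent[OF mono _ that] f_ge f_le[OF that] eq by simp
  \<comment> \<open>A negative level would give height at most \<open>- (n + 1) + (n - a)\<close>,
    which is below 0.\<close>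
  have bound: "f a \<le> 1 + 2 * a" if "a < n" for a
  proof (rule ccontr)
    assume "\<not> f a \<le> 1 + 2 * a"
    then have "(int n + 1) * (1 + 2 * int a - int (f a)) \<le> (int n + 1) * (- 1)"
      by (intro mult_left_mono) auto
    then have "z (f a) < 0" using z_f[OF that] by simp
    moreover have "z (f a) > 0"
      using path f_ge[OF that] f_le[OF that] by (auto simp: catalan_spitzer_path_def)
    ultimately show False by simp
  qed
  define h where "h a = 1 + 2 * a - f a" for a
  have h: "z (f a) = (int n + 1) * int (h a) + (int n - int a)" if "a < n" for a
    using z_f[OF that] bound[OF that] by (simp add: h_def of_nat_diff)
  have order': "\<sigma> ! a < \<sigma> ! b \<longleftrightarrow> h a < h b \<or> h a = h b \<and> b < a" if "a < n" "b < n" for a b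
    using order[OF that] lexicographic_height_less_iff[OF that] by (simp add: nth h that)
  have dist: "distinct \<sigma>" and len: "length \<sigma> = n"
    using perm by (auto simp: permutations_of_set_def distinct_card[symmetric])
  \<comment> \<open>This transports \<open>h\<close> from positions to letters; distinctness of
    \<sigma> makes the position unique.\<close>
  define L where "L x = h (THE a. a < n \<and> \<sigma> ! a = x)" for x
  have L: "L (\<sigma> ! a) = h a" if "a < n" for a
  proof -
    have "(THE b. b < n \<and> \<sigma> ! b = \<sigma> ! a) = a"
      using that dist len by (intro the_equality) (auto simp: nth_eq_iff_index_eq)
    then show ?thesis by (simp add: L_def)
  qed
  have "h 0 = 0" using f_ge[of 0] \<open>n \<ge> 1\<close> by (simp add: h_def)
  then have "L (hd \<sigma>) = 0" using L[of 0] \<open>n \<ge> 1\<close> len by (subst hd_conv_nth) auto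
  moreover have "successively (\<lambda>x y. L y \<le> L x + 1) \<sigma>"
    unfolding successively_conv_nth
  proof (intro allI impI)
    fix a assume a: "Suc a < length \<sigma>"
    then have "f a < f (Suc a)"
      using len by (intro strict_mono_onD[OF mono]) auto
    then show "L (\<sigma> ! Suc a) \<le> L (\<sigma> ! a) + 1"
      using a len L[of a] L[of "Suc a"] by (simp add: h_def)
  qed
  moreover have "sorted_wrt (\<lambda>x y. x < y \<longleftrightarrow> L x < L y) \<sigma>"
    unfolding sorted_wrt_iff_nth_less using order' L len by auto
  ultimately show "\<sigma> \<in> permutations_of_set {1..n} \<and> (\<exists>L. level_function L \<sigma>)"
    using perm by (auto simp: level_function_def)
next
  assume "\<sigma> \<in> permutations_of_set {1..n} \<and> (\<exists>L. level_function L \<sigma>)"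
  then obtain L where perm: "\<sigma> \<in> permutations_of_set {1..n}" and L: "level_function L \<sigma>"
    by blast
  have dist: "distinct \<sigma>" and len: "length \<sigma> = n"
    using perm by (auto simp: permutations_of_set_def distinct_card[symmetric])
  \<comment> \<open>Solving the formula for the level at the ascent index yields the positions of
    the required path.\<close>
  define f where "f a = 1 + 2 * a - L (\<sigma> ! a)" for a
  have le: "L (\<sigma> ! a) \<le> a" if "a < n" for a
    using level_function_nth_le[OF L] that len by simp
  have step: "f a < f (Suc a)" if "Suc a < n" for a
  proof -
    have "L (\<sigma> ! Suc a) \<le> L (\<sigma> ! a) + 1"
      using L that len by (auto simp: level_function_def successively_conv_nth)
    then show ?thesis using le[of a] le[of "Suc a"] that by (simp add: f_def)
  qed
  have less: "f a < f b" if "a < b" "b < n" for a b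
    using that
  proof (induction b)
    case (Suc b)
    then show ?case using step[of b] by (cases "a = b") auto
  qed simp
  then have mono: "strict_mono_on {..<n} f" by (auto simp: strict_mono_on_def)
  have f_ge: "1 \<le> f a" if "a < n" for a
    using le[OF that] by (simp add: f_def)
  then have ran: "f ` {..<n} \<subseteq> {1..2 * n}"
    by (force simp: f_def)
  have bound: "\<forall>a<n. f a \<le> 1 + 2 * a" by (simp add: f_def)
  have nth: "ascent_indices n (path_of_ascents n f) ! a = f a" if "a < n" for a
    using ascent_indices_path_of_ascents[OF mono ran] that by simp
  have height: "path_of_ascents n f (f a) = (int n + 1) * int (L (\<sigma> ! a)) + (int n - int a)"
    if "a < n" for a
    using path_of_ascents_at_ascent[OF mono _ that] f_ge le[OF that]
    by (simp add: f_def of_nat_diff)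
  have "\<sigma> ! a < \<sigma> ! b \<longleftrightarrow>
      path_of_ascents n f (f a) < path_of_ascents n f (f b)" if "a < n" "b < n" for a b
    using level_function_nth_less_iff[OF L dist] lexicographic_height_less_iff[OF that] that len
    by (simp add: height)
  then have "is_short_permutation_of_path n (path_of_ascents n f) \<sigma>"
    using perm by (simp add: is_short_permutation_of_path_def nth)
  then show "short_catalan_spitzer_permutation n \<sigma>"
    using catalan_spitzer_path_of_ascents[OF mono ran bound]
    by (auto simp: short_catalan_spitzer_permutation_def)
qed

section \<open>Effect of a flip on level functions\<close>

lemma level_function_move_right:
  assumes L: "level_function L (w1 @ (x # u) @ w3)" and "u \<noteq> []"
    and lt: "\<forall>y\<in>set w1 \<union> set w3. y < x" and gt: "\<forall>y\<in>set u. x < y"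
  shows "level_function (\<lambda>y. if x < y then L y - 1 else L y) (w1 @ (u @ [x]) @ w3)"
    (is "level_function ?M ?w")
proof -
  have succ: "successively (\<lambda>y z. L z \<le> L y + 1) (w1 @ (x # u) @ w3)"
    and sorted: "sorted_wrt (\<lambda>y z. y < z \<longleftrightarrow> L y < L z) (w1 @ (x # u) @ w3)"
    using L by (auto simp: level_function_def)
  have w1: "L y < L x" if "y \<in> set w1" for y
    using sorted lt that by (auto simp: sorted_wrt_append)
  \<comment> \<open>Strictness holds because \<open>x\<close> precedes these larger letters. Hence
    subtracting 1 is exact, and the lowered levels are still at least \<open>L x\<close>, as needed
    once \<open>x\<close> comes after \<open>u\<close>.\<close>
  have u: "L x < L y" if "y \<in> set u" for y
    using sorted gt that by (auto simp: sorted_wrt_append)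
  have w3: "L y \<le> L x" if "y \<in> set w3" for y
  proof -
    have "x < y \<longleftrightarrow> L x < L y" using sorted that by (simp add: sorted_wrt_append)
    moreover have "y < x" using lt that by simp
    ultimately show ?thesis by auto
  qed
  define M where "M = ?M"
  have M_u: "M y = L y - 1" if "y \<in> set u" for y using gt that by (simp add: M_def)
  have M_w: "M y = L y" if "y \<in> set w1 \<union> set w3" for y using bspec[OF lt that] by (auto simp: M_def)
  have M_x: "M x = L x" by (simp add: M_def)
  have hd_u: "hd u \<in> set u" and last_u: "last u \<in> set u" using \<open>u \<noteq> []\<close> by auto
  have "M (hd ?w) = 0"
  proof (cases "w1 = []")
    case True
    \<comment> \<open>Here \<open>x\<close> was the first letter, with level 0, so
      \<open>hd u\<close> had level at most 1 and drops to 0.\<close>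
    then show ?thesis
      using L succ \<open>u \<noteq> []\<close> M_u[OF hd_u]
      by (auto simp: level_function_def successively_append_iff successively_Cons)
  next
    case False
    then show ?thesis using L M_w[of "hd w1"] by (auto simp: level_function_def)
  qed
  moreover have "successively (\<lambda>y z. M z \<le> M y + 1) ?w"
  proof -
    have "successively (\<lambda>y z. M z \<le> M y + 1) w1" "successively (\<lambda>y z. M z \<le> M y + 1) w3"
      using succ by (auto simp: successively_append_iff M_w successively_Cons
          elim!: successively_mono)
    moreover have "successively (\<lambda>y z. M z \<le> M y + 1) u"
      by (rule successively_mono[where P = "\<lambda>y z. L z \<le> L y + 1"])
        (use succ u M_u \<open>u \<noteq> []\<close> in \<open>force simp: successively_append_iff successively_Cons\<close>)+
    \<comment> \<open>Lowering compensates for the removal of \<open>x\<close>: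
      \<open>L (hd u) - 1 \<le> L x \<le> L (last w1) + 1\<close>.\<close>
    moreover have "M (hd u) \<le> M (last w1) + 1" if "w1 \<noteq> []"
      using succ that \<open>u \<noteq> []\<close> M_u[OF hd_u] M_w[of "last w1"]
      by (auto simp: successively_append_iff successively_Cons)
    moreover have "M (hd w3) \<le> M x + 1" if "w3 \<noteq> []"
      using M_x w3[of "hd w3"] that M_w[of "hd w3"] by simp
    moreover have "M x \<le> M (last u) + 1"
      using M_x u[OF last_u] M_u[OF last_u] by simp
    ultimately show ?thesis
      using \<open>u \<noteq> []\<close> by (auto simp: successively_append_iff successively_Cons)
  qed
  moreover have "sorted_wrt (\<lambda>y z. y < z \<longleftrightarrow> M y < M z) ?w"
  proof -
    have "sorted_wrt (\<lambda>y z. y < z \<longleftrightarrow> M y < M z) u"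
    proof (rule sorted_wrt_mono_rel)
      show "sorted_wrt (\<lambda>y z. y < z \<longleftrightarrow> L y < L z) u"
        using sorted by (auto simp: sorted_wrt_append)
      show "y < z \<longleftrightarrow> M y < M z"
        if "y \<in> set u" "z \<in> set u" "y < z \<longleftrightarrow> L y < L z" for y z
        using that u[of y] u[of z] M_u by auto
    qed
    moreover have "sorted_wrt (\<lambda>y z. y < z \<longleftrightarrow> M y < M z) (w1 @ w3)"
    proof (rule sorted_wrt_mono_rel)
      show "sorted_wrt (\<lambda>y z. y < z \<longleftrightarrow> L y < L z) (w1 @ w3)"
        using sorted by (auto simp: sorted_wrt_append)
    qed (use M_w in auto)
    moreover have "y < z" "M y < M z" if "y \<in> set w1" "z \<in> set u" for y z
    proof -
      show "y < z" using lt gt that by (meson UnI1 less_trans)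
      \<comment> \<open>\<open>L x\<close> separates the two sides:
        \<open>L y < L x \<le> L z - 1\<close>.\<close>
      show "M y < M z" using w1[OF that(1)] u[OF that(2)] M_u[of z] M_w[of y] that by simp
    qed
    moreover have "\<not> y < z" "\<not> M y < M z" if "y \<in> set u" "z \<in> set w3" for y z
    proof -
      show "\<not> y < z" using lt gt that by (meson UnI2 less_trans less_asym)
      show "\<not> M y < M z" using w3[OF that(2)] u[OF that(1)] M_u[of y] M_w[of z] that by simp
    qed
    moreover have "y < x" "M y < M x" if "y \<in> set w1" for y
      using M_x w1[OF that] M_w[of y] bspec[OF lt, of y] that by auto
    moreover have "\<not> x < y" "\<not> M x < M y" if "y \<in> set w3" for y
      using M_x w3[OF that] M_w[of y] bspec[OF lt, of y] that by auto
    moreover have "\<not> y < x" "\<not> M y < M x" if "y \<in> set u" for y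
      using M_x u[OF that] M_u[OF that] gt that by auto
    ultimately show ?thesis
      by (auto simp: sorted_wrt_append)
  qed
  ultimately show ?thesis by (simp add: level_function_def M_def)
qed

text \<open>Letters of \<open>u\<close> exceed the later letter \<open>x\<close>, so their levels
  are at least \<open>L x\<close>; raising them by one gives the strict inequality required when
  \<open>x\<close> comes first. The delicate point is the new step from \<open>x\<close> to
  \<open>hd u\<close>, which needs \<open>L (hd u) \<le> L x\<close>.\<close>

lemma level_function_move_left:
  assumes L: "level_function L (w1 @ (u @ [x]) @ w3)" and "u \<noteq> []"
    and lt: "\<forall>y\<in>set w1 \<union> set w3. y < x" and gt: "\<forall>y\<in>set u. x < y"
  shows "level_function (\<lambda>y. if x < y then L y + 1 else L y) (w1 @ (x # u) @ w3)"
    (is "level_function ?M ?w")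
proof -
  have succ: "successively (\<lambda>y z. L z \<le> L y + 1) (w1 @ (u @ [x]) @ w3)"
    and sorted: "sorted_wrt (\<lambda>y z. y < z \<longleftrightarrow> L y < L z) (w1 @ (u @ [x]) @ w3)"
    using L by (auto simp: level_function_def)
  have w1: "L y < L x" if "y \<in> set w1" for y
    using sorted lt that by (auto simp: sorted_wrt_append)
  have u: "L x \<le> L y" if "y \<in> set u" for y
  proof -
    have "y < x \<longleftrightarrow> L y < L x" using sorted that by (simp add: sorted_wrt_append)
    moreover have "x < y" using gt that by simp
    ultimately show ?thesis by auto
  qed
  have w3: "L y \<le> L x" if "y \<in> set w3" for y
  proof -
    have "x < y \<longleftrightarrow> L x < L y" using sorted that by (simp add: sorted_wrt_append)
    moreover have "y < x" using lt that by simp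
    ultimately show ?thesis by auto
  qed
  define M where "M = ?M"
  have M_u: "M y = L y + 1" if "y \<in> set u" for y using gt that by (simp add: M_def)
  have M_w: "M y = L y" if "y \<in> set w1 \<union> set w3" for y using bspec[OF lt that] by (auto simp: M_def)
  have M_x: "M x = L x" by (simp add: M_def)
  have hd_u: "hd u \<in> set u" and last_u: "last u \<in> set u" using \<open>u \<noteq> []\<close> by auto
  \<comment> \<open>The letter before \<open>hd u\<close> is smaller than \<open>x\<close> and precedes it, so its level is below that of \<open>x\<close>.\<close>
  have hd_le: "L (hd u) \<le> L x"
  proof (cases "w1 = []")
    case True
    then show ?thesis using L \<open>u \<noteq> []\<close> by (auto simp: level_function_def)
  next
    case False
    then have "L (hd u) \<le> L (last w1) + 1"
      using succ \<open>u \<noteq> []\<close> by (auto simp: successively_append_iff)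
    then show ?thesis using w1[of "last w1"] False by simp
  qed
  have "M (hd ?w) = 0"
  proof (cases "w1 = []")
    case True
    \<comment> \<open>The old first letter \<open>hd u\<close> has level 0 and
      \<open>L x \<le> L (hd u)\<close>, so the new first letter \<open>x\<close> also has level
      0.\<close>
    then show ?thesis
      using L \<open>u \<noteq> []\<close> u[OF hd_u] M_x by (auto simp: level_function_def)
  next
    case False
    then show ?thesis using L M_w[of "hd w1"] by (auto simp: level_function_def)
  qed
  moreover have "successively (\<lambda>y z. M z \<le> M y + 1) ?w"
  proof -
    have "successively (\<lambda>y z. M z \<le> M y + 1) w1" "successively (\<lambda>y z. M z \<le> M y + 1) w3"
      using succ by (auto simp: successively_append_iff M_w successively_Cons
          elim!: successively_mono)
    moreover have "successively (\<lambda>y z. M z \<le> M y + 1) u"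
      by (rule successively_mono[where P = "\<lambda>y z. L z \<le> L y + 1"])
        (use succ M_u in \<open>auto simp: successively_append_iff\<close>)
    moreover have "M x \<le> M (last w1) + 1" if "w1 \<noteq> []"
      using M_x succ that \<open>u \<noteq> []\<close> u[OF hd_u] M_w[of "last w1"]
      by (auto simp: successively_append_iff)
    moreover have "M (hd u) \<le> M x + 1"
      using M_x hd_le M_u[OF hd_u] by simp
    moreover have "M (hd w3) \<le> M (last u) + 1" if "w3 \<noteq> []"
      using w3[of "hd w3"] that M_w[of "hd w3"] M_u[OF last_u] u[OF last_u] by simp
    ultimately show ?thesis
      using \<open>u \<noteq> []\<close> by (auto simp: successively_append_iff successively_Cons)
  qed
  moreover have "sorted_wrt (\<lambda>y z. y < z \<longleftrightarrow> M y < M z) ?w"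
  proof -
    have "sorted_wrt (\<lambda>y z. y < z \<longleftrightarrow> M y < M z) u"
    proof (rule sorted_wrt_mono_rel)
      show "sorted_wrt (\<lambda>y z. y < z \<longleftrightarrow> L y < L z) u"
        using sorted by (auto simp: sorted_wrt_append)
    qed (use M_u in auto)
    moreover have "sorted_wrt (\<lambda>y z. y < z \<longleftrightarrow> M y < M z) (w1 @ w3)"
    proof (rule sorted_wrt_mono_rel)
      show "sorted_wrt (\<lambda>y z. y < z \<longleftrightarrow> L y < L z) (w1 @ w3)"
        using sorted by (auto simp: sorted_wrt_append)
    qed (use M_w in auto)
    moreover have "y < z" "M y < M z" if "y \<in> set w1" "z \<in> set u" for y z
    proof -
      show "y < z" using lt gt that by (meson UnI1 less_trans)
      show "M y < M z" using w1[OF that(1)] u[OF that(2)] M_u[of z] M_w[of y] that by simp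
    qed
    moreover have "\<not> y < z" "\<not> M y < M z" if "y \<in> set u" "z \<in> set w3" for y z
    proof -
      show "\<not> y < z" using lt gt that by (meson UnI2 less_trans less_asym)
      show "\<not> M y < M z" using w3[OF that(2)] u[OF that(1)] M_u[of y] M_w[of z] that by simp
    qed
    moreover have "y < x" "M y < M x" if "y \<in> set w1" for y
      using M_x w1[OF that] M_w[of y] bspec[OF lt, of y] that by auto
    moreover have "\<not> x < y" "\<not> M x < M y" if "y \<in> set w3" for y
      using M_x w3[OF that] M_w[of y] bspec[OF lt, of y] that by auto
    moreover have "x < y" "M x < M y" if "y \<in> set u" for y
      using M_x u[OF that] M_u[OF that] gt that by auto
    ultimately show ?thesis
      by (auto simp: sorted_wrt_append)
  qed
  ultimately show ?thesis by (simp add: level_function_def M_def)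
qed

lemma level_function_flip:
  assumes L: "level_function L w" and dec: "decomposable x w" and ex: "\<exists>y\<in>set w. x < y"
  shows "\<exists>L'. level_function L' (flip x w)"
proof -
  obtain w1 w2 w3 where d: "is_decomposition x w w1 w2 w3"
    using dec by (auto simp: decomposable_def)
  then have w: "w = w1 @ w2 @ w3" and dist: "distinct w" and "w2 \<noteq> []"
    and lt: "\<forall>y\<in>set w1 \<union> set w3. y < x" and ge: "\<forall>y\<in>set w2. y \<ge> x"
    and ends: "hd w2 = x \<or> last w2 = x"
    by (auto simp: is_decomposition_def)
  \<comment> \<open>A letter above \<open>x\<close> must lie in \<open>w2\<close>, so the part
    \<open>u\<close> that \<open>x\<close> jumps over is nonempty.\<close>
  obtain y where y: "y \<in> set w2" "x < y" using ex lt w by (force dest: less_asym)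
  show ?thesis
  proof (cases "hd w2 = x")
    case True
    then obtain u where u: "w2 = x # u" using \<open>w2 \<noteq> []\<close> by (cases w2) auto
    then have "u \<noteq> []" "\<forall>y\<in>set u. x < y" using y ge dist w by (auto simp: order.strict_iff_order)
    then have "\<exists>L'. level_function L' (w1 @ (u @ [x]) @ w3)"
      using level_function_move_right[of L w1 x u w3] L lt w u by blast
    then show ?thesis by (simp add: flip_eq[OF d] move_to_other_end_def u)
  next
    case False
    then obtain u where u: "w2 = u @ [x]"
      using ends \<open>w2 \<noteq> []\<close> by (metis append_butlast_last_id)
    then have "u \<noteq> []" "\<forall>y\<in>set u. x < y" using y ge dist w by (auto simp: order.strict_iff_order)
    then have "\<exists>L'. level_function L' (w1 @ (x # u) @ w3)"
      using level_function_move_left[of L w1 u x w3] L lt w u by blast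
    then show ?thesis using False by (simp add: flip_eq[OF d] move_to_other_end_def u)
  qed
qed

lemma mset_flip:
  assumes "decomposable x w"
  shows "mset (flip x w) = mset w"
proof -
  obtain w1 w2 w3 where d: "is_decomposition x w w1 w2 w3"
    using assms by (auto simp: decomposable_def)
  then have w: "w = w1 @ w2 @ w3" and "w2 \<noteq> []" and ends: "hd w2 = x \<or> last w2 = x"
    by (auto simp: is_decomposition_def)
  have "mset (move_to_other_end x w2) = mset w2"
  proof (cases "hd w2 = x")
    case True
    then show ?thesis using \<open>w2 \<noteq> []\<close> by (cases w2) (auto simp: move_to_other_end_def)
  next
    case False
    then obtain u where "w2 = u @ [x]"
      using ends \<open>w2 \<noteq> []\<close> by (metis append_butlast_last_id)
    then show ?thesis using False by (auto simp: move_to_other_end_def)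
  qed
  then show ?thesis unfolding flip_eq[OF d] by (simp add: w)
qed

theorem theorem5p5:
  fixes n i :: nat and \<sigma> :: "nat list"
  assumes "n \<ge> 1"
    and "short_catalan_spitzer_permutation n \<sigma>"
    and "i < n"
    and "decomposable i \<sigma>"
  shows "short_catalan_spitzer_permutation n (flip i \<sigma>)"
proof -
  obtain L where perm: "\<sigma> \<in> permutations_of_set {1..n}" and L: "level_function L \<sigma>"
    using assms(2) short_catalan_spitzer_permutation_iff_level_function[OF assms(1)] by blast
  \<comment> \<open>Since \<open>i < n\<close>, the letter \<open>n\<close> is the witness for a
    letter above \<open>i\<close>.\<close>
  have "n \<in> set \<sigma>" using perm \<open>n \<ge> 1\<close> by (auto simp: permutations_of_set_def)
  then have "\<exists>L'. level_function L' (flip i \<sigma>)"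
    using level_function_flip[OF L assms(4)] \<open>i < n\<close> by blast
  moreover have "flip i \<sigma> \<in> permutations_of_set {1..n}"
    using perm mset_eq_setD[OF mset_flip[OF assms(4)]]
      mset_eq_imp_distinct_iff[OF mset_flip[OF assms(4)]]
    by (simp add: permutations_of_set_def)
  ultimately show ?thesis
    using short_catalan_spitzer_permutation_iff_level_function[OF assms(1)] by blast
qed

end
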